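(* Let $(R,\sigma)$ be a $\sigma$-Euclidean ring with stathm $\Phi$, and let $f_\Phi:R\times R\to R\times R$ be a function such that whenever $a,b\in R$, $b\neq0$ and $a\sigma(b)\in R^+$, one has $f_\Phi(a,b)=(q,a-bq)$ with $q\in R^+$ and $\Phi(a-bq)<\Phi(b)$. Let $a,b\in R$ with $a\sigma(b)\in R^+$. Consider the procedure that sets $r_0=a$, $r_1=b$, $s_0=1$, $s_1=0$, $t_0=0$, $t_1=-1$, and for $i\ge2$, as long as $r_{i-1}\neq0$, computes $(q,r_i)=f_\Phi(r_{i-2},r_{i-1})$ and sets $s_i=s_{i-2}-qs_{i-1}$ and $t_i=t_{i-2}-qt_{i-1}$, stopping as soon as the last element $r_{k+1}$ of the list of $r$'s is $0$. Then this procedure terminates, returning finite sequences $r_i,s_i,t_i$ in $R$ ($0\le i\le k+1$) such that: 1. $r_{k+1}=0$. 2. $r_k$ is a right GCD of $a$ and $b$. 3. $a\sigma(s_i)-b\sigma(t_i)=r_i$ for all $i$, and $s_i\sigma(t_i)\in R^+$. 4. For all $i$ with $0\le i\le k$, $\begin{pmatrix}t_i&s_i\\(-1)^it_{i+1}&(-1)^is_{i+1}\end{pmatrix}\in E^\sigma(2,R)$.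
   Context: Rings are unital. An involution on a ring $R$ is an additive map $\sigma:R\to R$ with $\sigma(xy)=\sigma(y)\sigma(x)$ and $\sigma(\sigma(x))=x$ for all $x,y$; write $R^+=\{r\in R\mid\sigma(r)=r\}$. A ring with involution $(R,\sigma)$ without zero divisors is $\sigma$-Euclidean with stathm $\Phi$ if $\Phi:R\to W$ is a function to a well-ordered set $W$ such that for all $a,b\in R$ with $b\neq0$ and $a\sigma(b)\in R^+$ there exists $q\in R^+$ with $\Phi(a-bq)<\Phi(b)$. A right GCD of $a,b$ is an element $g\in R$ with $a,b\in gR$ and such that any $r\in R$ with $a,b\in rR$ satisfies $g\in rR$. $E^\sigma(2,R)$ is the group generated by the matrices $\begin{pmatrix}1&\tau\\0&1\end{pmatrix}$, $\begin{pmatrix}u&0\\0&\sigma(u)^{-1}\end{pmatrix}$, $\begin{pmatrix}0&1\\-1&0\end{pmatrix}$ with $\tau\in R^+$ and $u\in R^\times$; it is a subgroup of the group of $M\in\mathrm{Mat}(2,R)$ with $M\hat\sigma(M)=\hat\sigma(M)M=1$, where $\hat\sigma\begin{pmatrix}a&b\\c&d\end{pmatrix}=\begin{pmatrix}\sigma(d)&-\sigma(b)\\-\sigma(c)&\sigma(a)\end{pmatrix}$. *)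

theory Defs
  imports
    "HOL-Analysis.Cartesian_Space"
    "HOL-Algebra.Generated_Groups"
    "HOL-Library.While_Combinator"
begin

definition involution :: "('a::ring_1 \<Rightarrow> 'a) \<Rightarrow> bool" where
  "involution \<sigma> \<longleftrightarrow>
     (\<forall>x y. \<sigma> (x + y) = \<sigma> x + \<sigma> y) \<and>
     (\<forall>x y. \<sigma> (x * y) = \<sigma> y * \<sigma> x) \<and>
     (\<forall>x. \<sigma> (\<sigma> x) = x)"

definition sym_elems :: "('a \<Rightarrow> 'a) \<Rightarrow> 'a set" where
  "sym_elems \<sigma> = {r. \<sigma> r = r}"

text \<open>The absence of zero divisors is carried by the type class.\<close>

definition sigma_Euclidean ::
  "('a::ring_1_no_zero_divisors \<Rightarrow> 'a) \<Rightarrow> ('a \<Rightarrow> 'w::wellorder) \<Rightarrow> bool" where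
  "sigma_Euclidean \<sigma> \<Phi> \<longleftrightarrow>
     involution \<sigma> \<and>
     (\<forall>a b. b \<noteq> 0 \<longrightarrow> a * \<sigma> b \<in> sym_elems \<sigma> \<longrightarrow>
        (\<exists>q\<in>sym_elems \<sigma>. \<Phi> (a - b * q) < \<Phi> b))"

definition division_function ::
  "('a::ring_1 \<Rightarrow> 'a) \<Rightarrow> ('a \<Rightarrow> 'w::wellorder) \<Rightarrow> ('a \<times> 'a \<Rightarrow> 'a \<times> 'a) \<Rightarrow> bool" where
  "division_function \<sigma> \<Phi> f \<longleftrightarrow>
     (\<forall>a b. b \<noteq> 0 \<longrightarrow> a * \<sigma> b \<in> sym_elems \<sigma> \<longrightarrow>
        (\<exists>q\<in>sym_elems \<sigma>. f (a, b) = (q, a - b * q) \<and> \<Phi> (a - b * q) < \<Phi> b))"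

definition right_ideal :: "'a::ring_1 \<Rightarrow> 'a set" where
  "right_ideal g = {g * x | x. True}"

definition is_right_gcd :: "'a::ring_1 \<Rightarrow> 'a \<Rightarrow> 'a \<Rightarrow> bool" where
  "is_right_gcd g a b \<longleftrightarrow>
     a \<in> right_ideal g \<and> b \<in> right_ideal g \<and>
     (\<forall>r. a \<in> right_ideal r \<and> b \<in> right_ideal r \<longrightarrow> g \<in> right_ideal r)"

definition is_inverse :: "'a::ring_1 \<Rightarrow> 'a \<Rightarrow> bool" where
  "is_inverse u v \<longleftrightarrow> u * v = 1 \<and> v * u = 1"

definition mat2 :: "'a::ring_1 \<Rightarrow> 'a \<Rightarrow> 'a \<Rightarrow> 'a \<Rightarrow> 'a^2^2" where
  "mat2 a b c d = vector [vector [a, b], vector [c, d]]"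

definition sigma_hat :: "('a::ring_1 \<Rightarrow> 'a) \<Rightarrow> 'a^2^2 \<Rightarrow> 'a^2^2" where
  "sigma_hat \<sigma> M = mat2 (\<sigma> (M$2$2)) (- \<sigma> (M$1$2)) (- \<sigma> (M$2$1)) (\<sigma> (M$1$1))"

definition SL_sigma :: "('a::ring_1 \<Rightarrow> 'a) \<Rightarrow> ('a^2^2) monoid" where
  "SL_sigma \<sigma> =
     \<lparr>carrier = {M. M ** sigma_hat \<sigma> M = mat 1 \<and> sigma_hat \<sigma> M ** M = mat 1},
      monoid.mult = (**), one = mat 1\<rparr>"

definition E_sigma_generators :: "('a::ring_1 \<Rightarrow> 'a) \<Rightarrow> ('a^2^2) set" where
  "E_sigma_generators \<sigma> =
     {mat2 1 \<tau> 0 1 | \<tau>. \<tau> \<in> sym_elems \<sigma>} \<union>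
     {mat2 u 0 0 w | u w. (\<exists>v. is_inverse u v) \<and> is_inverse (\<sigma> u) w} \<union>
     {mat2 0 1 (- 1) 0}"

definition E_sigma :: "('a::ring_1 \<Rightarrow> 'a) \<Rightarrow> ('a^2^2) set" where
  "E_sigma \<sigma> = generate (SL_sigma \<sigma>) (E_sigma_generators \<sigma>)"

text \<open>
  The state consists of the lists of the \<open>r\<close>'s, \<open>s\<close>'s and \<open>t\<close>'s computed so far;
  one step appends the entries of index \<open>i\<close>, where \<open>i\<close> is the current length.
\<close>

definition euclid_step ::
  "('a::ring_1 \<times> 'a \<Rightarrow> 'a \<times> 'a) \<Rightarrow> 'a list \<times> 'a list \<times> 'a list \<Rightarrow> 'a list \<times> 'a list \<times> 'a list"
  where
  "euclid_step f = (\<lambda>(r, s, t).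
     let i = length r;
         (q, r') = f (r ! (i - 2), r ! (i - 1))
     in (r @ [r'],
         s @ [s ! (i - 2) - q * s ! (i - 1)],
         t @ [t ! (i - 2) - q * t ! (i - 1)]))"

text \<open>The value is \<open>None\<close> if and only if the loop does not terminate.\<close>

definition euclid ::
  "('a::ring_1 \<times> 'a \<Rightarrow> 'a \<times> 'a) \<Rightarrow> 'a \<Rightarrow> 'a \<Rightarrow> ('a list \<times> 'a list \<times> 'a list) option" where
  "euclid f a b =
     while_option (\<lambda>(r, s, t). last r \<noteq> 0) (euclid_step f) ([a, b], [1, 0], [0, - 1])"

text \<open>
  The following facts justify forming the generated subgroup inside \<open>SL_sigma \<sigma>\<close>.
\<close>

lemma mat2_nth [simp]:
  "mat2 a b c d $ 1 $ 1 = a" "mat2 a b c d $ 1 $ 2 = b"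
  "mat2 a b c d $ 2 $ 1 = c" "mat2 a b c d $ 2 $ 2 = d"
  by (simp_all add: mat2_def)

lemma mat2_eq_iff:
  "M = N \<longleftrightarrow> M$1$1 = N$1$1 \<and> M$1$2 = N$1$2 \<and> M$2$1 = N$2$1 \<and> M$2$2 = N$2$2"
  for M N :: "'a^2^2"
  by (auto simp: vec_eq_iff forall_2)

lemma mat2_mult_nth: "(M ** N) $ i $ j = M$i$1 * N$1$j + M$i$2 * N$2$j"
  for M N :: "'a::ring_1^2^2"
  by (simp add: matrix_matrix_mult_def sum_2)

lemma involution_simps:
  assumes "involution \<sigma>"
  shows "\<sigma> (x + y) = \<sigma> x + \<sigma> y" "\<sigma> (x * y) = \<sigma> y * \<sigma> x" "\<sigma> (\<sigma> x) = x"
    "\<sigma> 0 = 0" "\<sigma> (- x) = - \<sigma> x" "\<sigma> 1 = 1"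
proof -
  show add: "\<sigma> (x + y) = \<sigma> x + \<sigma> y" and mul: "\<sigma> (x * y) = \<sigma> y * \<sigma> x"
    and inv: "\<sigma> (\<sigma> x) = x" for x y
    using assms by (simp_all add: involution_def)
  show zero: "\<sigma> 0 = 0"
    using add[of 0 0] by simp
  show "\<sigma> (- x) = - \<sigma> x"
    using add[of x "- x"] zero by (simp add: eq_neg_iff_add_eq_0 add.commute)
  show "\<sigma> 1 = 1"
    using mul[of 1 "\<sigma> 1"] inv[of 1] by simp
qed

lemma sigma_hat_mult:
  assumes "involution \<sigma>"
  shows "sigma_hat \<sigma> (M ** N) = sigma_hat \<sigma> N ** sigma_hat \<sigma> M"
  by (simp add: mat2_eq_iff mat2_mult_nth sigma_hat_def involution_simps[OF assms] add.commute)

lemma sigma_hat_sigma_hat: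
  assumes "involution \<sigma>"
  shows "sigma_hat \<sigma> (sigma_hat \<sigma> M) = M"
  by (simp add: mat2_eq_iff sigma_hat_def involution_simps[OF assms])

lemma sigma_hat_one:
  assumes "involution \<sigma>"
  shows "sigma_hat \<sigma> (mat 1) = mat 1"
  by (simp add: mat2_eq_iff sigma_hat_def mat_def involution_simps[OF assms])

lemma group_SL_sigma:
  assumes "involution \<sigma>"
  shows "group (SL_sigma \<sigma>)"
proof (rule groupI)
  fix M N
  assume "M \<in> carrier (SL_sigma \<sigma>)" "N \<in> carrier (SL_sigma \<sigma>)"
  then have M: "M ** sigma_hat \<sigma> M = mat 1" "sigma_hat \<sigma> M ** M = mat 1"
    and N: "N ** sigma_hat \<sigma> N = mat 1" "sigma_hat \<sigma> N ** N = mat 1"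
    by (simp_all add: SL_sigma_def)
  have "(M ** N) ** (sigma_hat \<sigma> N ** sigma_hat \<sigma> M) = M ** (N ** sigma_hat \<sigma> N) ** sigma_hat \<sigma> M"
    by (simp add: matrix_mul_assoc)
  moreover have "(sigma_hat \<sigma> N ** sigma_hat \<sigma> M) ** (M ** N) = sigma_hat \<sigma> N ** (sigma_hat \<sigma> M ** M) ** N"
    by (simp add: matrix_mul_assoc)
  ultimately show "M \<otimes>\<^bsub>SL_sigma \<sigma>\<^esub> N \<in> carrier (SL_sigma \<sigma>)"
    using M N by (simp add: SL_sigma_def sigma_hat_mult[OF assms])
next
  fix M
  assume "M \<in> carrier (SL_sigma \<sigma>)"
  then show "\<exists>N\<in>carrier (SL_sigma \<sigma>). N \<otimes>\<^bsub>SL_sigma \<sigma>\<^esub> M = \<one>\<^bsub>SL_sigma \<sigma>\<^esub>"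
    by (intro bexI[of _ "sigma_hat \<sigma> M"]) (simp_all add: SL_sigma_def sigma_hat_sigma_hat[OF assms])
qed (simp_all add: SL_sigma_def sigma_hat_one[OF assms] matrix_mul_assoc)

lemma E_sigma_generators_subset:
  assumes "involution \<sigma>"
  shows "E_sigma_generators \<sigma> \<subseteq> carrier (SL_sigma \<sigma>)"
proof -
  have transvection: "mat2 1 \<tau> 0 1 \<in> carrier (SL_sigma \<sigma>)" if "\<tau> \<in> sym_elems \<sigma>" for \<tau>
    using that
    by (simp add: SL_sigma_def sym_elems_def mat2_eq_iff mat2_mult_nth sigma_hat_def mat_def
        involution_simps[OF assms])
  have diagonal: "mat2 u 0 0 w \<in> carrier (SL_sigma \<sigma>)" if "is_inverse (\<sigma> u) w" for u w
  proof -
    have w: "\<sigma> u * w = 1" "w * \<sigma> u = 1"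
      using that by (simp_all add: is_inverse_def)
    have "u * \<sigma> w = \<sigma> (w * \<sigma> u)" "\<sigma> w * u = \<sigma> (\<sigma> u * w)"
      by (simp_all add: involution_simps(2,3)[OF assms])
    with w have "u * \<sigma> w = 1" "\<sigma> w * u = 1"
      by (simp_all only: involution_simps(6)[OF assms])
    with w show ?thesis
      by (simp add: SL_sigma_def mat2_eq_iff mat2_mult_nth sigma_hat_def mat_def
          involution_simps(4-6)[OF assms])
  qed
  have "mat2 0 1 (- 1) 0 \<in> carrier (SL_sigma \<sigma>)"
    by (simp add: SL_sigma_def mat2_eq_iff mat2_mult_nth sigma_hat_def mat_def
        involution_simps(4-6)[OF assms])
  with transvection diagonal show ?thesis
    unfolding E_sigma_generators_def by blast
qed

end

theory Submission
  imports Defs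
begin

text \<open>
  The right ideal generated by two consecutive remainders does not change when one passes from
  \<open>(r\<^bsub>i-2\<^esub>, r\<^bsub>i-1\<^esub>)\<close> to \<open>(r\<^bsub>i-1\<^esub>, r\<^bsub>i-2\<^esub> - r\<^bsub>i-1\<^esub> q)\<close>, so the common left factors of such a pair are
  those of \<open>a\<close> and \<open>b\<close>; once the second remainder is \<open>0\<close>, the first is a right GCD.  The division
  can always be carried out, because symmetry of \<open>q\<close> propagates the condition
  \<open>r\<^bsub>i-2\<^esub> * \<sigma> r\<^bsub>i-1\<^esub> \<in> R\<^sup>+\<close> (\<open>sym_elems_mult_sigma_step\<close>), and the values \<open>\<Phi> r\<^bsub>i\<^esub>\<close> strictly decrease in
  a well-order, so the procedure stops.  The relation \<open>a * \<sigma> s\<^bsub>i\<^esub> - b * \<sigma> t\<^bsub>i\<^esub> = r\<^bsub>i\<^esub>\<close> passes on because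
  \<open>\<sigma> (q * s) = \<sigma> s * q\<close>.

  Let \<open>M\<^sub>i\<close> be the matrix with rows \<open>(t\<^bsub>i\<^esub>, s\<^bsub>i\<^esub>)\<close> and \<open>(\<epsilon> t\<^bsub>i+1\<^esub>, \<epsilon> s\<^bsub>i+1\<^esub>)\<close>, where \<open>\<epsilon> = (-1)\<^sup>i\<close>.
  Then \<open>M\<^sub>0 = (0, 1; -1, 0)\<close> is a generator, and \<open>M\<^bsub>i+1\<^esub> = (0, \<epsilon>; -\<epsilon>, q) M\<^sub>i\<close> with
  \<open>(0, \<epsilon>; -\<epsilon>, q) = diag(\<epsilon>, \<epsilon>) (0, 1; -1, 0) (1, -\<epsilon> q; 0, 1)\<close>, a product of generators
  (\<open>E_sigma_step_matrix\<close>); so all \<open>M\<^sub>i\<close> lie in the elementary group.  Finally, a matrix with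
  \<open>M ** sigma_hat \<sigma> M = mat 1\<close> has rows \<open>(t, s)\<close> with \<open>s * \<sigma> t\<close> symmetric
  (\<open>SL_sigma_rows_symmetric\<close>), and every pair \<open>(t\<^bsub>i\<^esub>, s\<^bsub>i\<^esub>)\<close> is up to sign a row of such a matrix.
\<close>

section \<open>Symmetric elements and right ideals\<close>

lemma sym_elems_mult_sigma_iff:
  assumes "involution \<sigma>"
  shows "x * \<sigma> y \<in> sym_elems \<sigma> \<longleftrightarrow> x * \<sigma> y = y * \<sigma> x"
  by (auto simp: sym_elems_def involution_simps[OF assms])

lemma sigma_diff:
  assumes "involution \<sigma>"
  shows "\<sigma> (x - y) = \<sigma> x - \<sigma> y"
  using involution_simps(1)[OF assms, of x "- y"] involution_simps(5)[OF assms, of y] by simp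

lemma sym_elems_mult_sigma_step:
  assumes "involution \<sigma>" and "x * \<sigma> y \<in> sym_elems \<sigma>" and "q \<in> sym_elems \<sigma>"
  shows "y * \<sigma> (x - y * q) \<in> sym_elems \<sigma>"
proof -
  have "\<sigma> q = q" "x * \<sigma> y = y * \<sigma> x"
    using assms(3) assms(2)[unfolded sym_elems_mult_sigma_iff[OF assms(1)]]
    by (simp_all add: sym_elems_def)
  then show ?thesis
    unfolding sym_elems_mult_sigma_iff[OF assms(1)]
    by (simp add: sigma_diff[OF assms(1)]
        involution_simps[OF assms(1)] algebra_simps)
qed

lemma right_ideal_diff_mult_iff:
  assumes "y \<in> right_ideal g"
  shows "x - y * q \<in> right_ideal g \<longleftrightarrow> x \<in> right_ideal g"
proof -
  obtain c where y: "y = g * c"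
    using assms by (auto simp: right_ideal_def)
  have "x - y * q = g * d \<longleftrightarrow> x = g * (d + c * q)" for d
    by (auto simp: y algebra_simps)
  moreover have "x = g * e \<longleftrightarrow> x - y * q = g * (e - c * q)" for e
    by (auto simp: y algebra_simps)
  ultimately show ?thesis
    unfolding right_ideal_def by blast
qed

lemma self_in_right_ideal: "x \<in> right_ideal x"
  by (auto simp: right_ideal_def intro: exI[of _ 1])

lemma zero_in_right_ideal: "0 \<in> right_ideal x"
  by (auto simp: right_ideal_def intro: exI[of _ 0])

section \<open>The elementary group\<close>

lemma E_sigma_generator:
  assumes "M \<in> E_sigma_generators \<sigma>"
  shows "M \<in> E_sigma \<sigma>"
  using assms unfolding E_sigma_def by (rule generate.incl)

lemma E_sigma_mult:
  assumes "M \<in> E_sigma \<sigma>" and "N \<in> E_sigma \<sigma>"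
  shows "M ** N \<in> E_sigma \<sigma>"
  using generate.eng[of M "SL_sigma \<sigma>" "E_sigma_generators \<sigma>" N] assms
  by (simp add: E_sigma_def SL_sigma_def)

lemma E_sigma_subset_SL_sigma:
  assumes "involution \<sigma>"
  shows "E_sigma \<sigma> \<subseteq> carrier (SL_sigma \<sigma>)"
  unfolding E_sigma_def
  using group.generate_incl[OF group_SL_sigma[OF assms] E_sigma_generators_subset[OF assms]] .

lemma SL_sigma_rows_symmetric:
  assumes "involution \<sigma>" and "M \<in> carrier (SL_sigma \<sigma>)"
  shows "M $ 1 $ 2 * \<sigma> (M $ 1 $ 1) \<in> sym_elems \<sigma>"
    and "M $ 2 $ 2 * \<sigma> (M $ 2 $ 1) \<in> sym_elems \<sigma>"
proof -
  have "M ** sigma_hat \<sigma> M = mat 1"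
    using assms(2) by (simp add: SL_sigma_def)
  then have "(M ** sigma_hat \<sigma> M) $ 1 $ 2 = 0" "(M ** sigma_hat \<sigma> M) $ 2 $ 1 = 0"
    by (simp_all add: mat_def)
  then show "M $ 1 $ 2 * \<sigma> (M $ 1 $ 1) \<in> sym_elems \<sigma>" "M $ 2 $ 2 * \<sigma> (M $ 2 $ 1) \<in> sym_elems \<sigma>"
    by (simp_all add: mat2_mult_nth sigma_hat_def sym_elems_mult_sigma_iff[OF assms(1)])
qed

lemma weyl_element_in_E_sigma: "mat2 0 1 (- 1) 0 \<in> E_sigma \<sigma>"
  by (rule E_sigma_generator) (simp add: E_sigma_generators_def)

lemma E_sigma_step_matrix:
  assumes "involution \<sigma>" and "q \<in> sym_elems \<sigma>" and "\<epsilon> = 1 \<or> \<epsilon> = - 1"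
  shows "mat2 0 \<epsilon> (- \<epsilon>) q \<in> E_sigma \<sigma>"
proof -
  have "is_inverse \<epsilon> \<epsilon>" "is_inverse (\<sigma> \<epsilon>) \<epsilon>" and sq: "\<epsilon> * (\<epsilon> * x) = x" for x
    using assms(3) by (auto simp: is_inverse_def involution_simps[OF assms(1)])
  then have "mat2 \<epsilon> 0 0 \<epsilon> \<in> E_sigma_generators \<sigma>"
    unfolding E_sigma_generators_def by blast
  moreover have "- (\<epsilon> * q) \<in> sym_elems \<sigma>"
    using assms(2,3) by (auto simp: sym_elems_def involution_simps[OF assms(1)])
  then have "mat2 1 (- (\<epsilon> * q)) 0 1 \<in> E_sigma_generators \<sigma>"
    unfolding E_sigma_generators_def by auto
  ultimately have "mat2 \<epsilon> 0 0 \<epsilon> ** (mat2 0 1 (- 1) 0 ** mat2 1 (- (\<epsilon> * q)) 0 1) \<in> E_sigma \<sigma>"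
    by (intro E_sigma_mult weyl_element_in_E_sigma E_sigma_generator)
  also have "mat2 \<epsilon> 0 0 \<epsilon> ** (mat2 0 1 (- 1) 0 ** mat2 1 (- (\<epsilon> * q)) 0 1) = mat2 0 \<epsilon> (- \<epsilon>) q"
    by (simp add: mat2_eq_iff mat2_mult_nth sq)
  finally show ?thesis .
qed

lemma E_sigma_step:
  assumes "involution \<sigma>" and "q \<in> sym_elems \<sigma>"
    and "mat2 t s ((- 1) ^ i * t') ((- 1) ^ i * s') \<in> E_sigma \<sigma>"
  shows "mat2 t' s' ((- 1) ^ Suc i * (t - q * t')) ((- 1) ^ Suc i * (s - q * s')) \<in> E_sigma \<sigma>"
proof -
  define \<epsilon> :: 'a where "\<epsilon> = (- 1) ^ i"
  have \<epsilon>: "\<epsilon> = 1 \<or> \<epsilon> = - 1"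
    by (cases "even i") (simp_all add: \<epsilon>_def)
  have "mat2 0 \<epsilon> (- \<epsilon>) q ** mat2 t s (\<epsilon> * t') (\<epsilon> * s') \<in> E_sigma \<sigma>"
    using E_sigma_step_matrix[OF assms(1,2) \<epsilon>] assms(3) unfolding \<epsilon>_def by (rule E_sigma_mult)
  also have "mat2 0 \<epsilon> (- \<epsilon>) q ** mat2 t s (\<epsilon> * t') (\<epsilon> * s') =
      mat2 t' s' (- \<epsilon> * (t - q * t')) (- \<epsilon> * (s - q * s'))"
    using \<epsilon> by (auto simp: mat2_eq_iff mat2_mult_nth algebra_simps)
  finally show ?thesis
    by (simp add: \<epsilon>_def)
qed

section \<open>The loop invariant\<close>

text \<open>
  The conditions on the lists that hold before and after each step; \<open>k + 1\<close> is the index of the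
  last entries.  The two conditions on remainders concern the last two of them only: they allow
  the next division, and they say that the common left factors of this pair are those of
  \<open>a\<close> and \<open>b\<close>.
\<close>

definition euclid_inv ::
  "('a::ring_1 \<Rightarrow> 'a) \<Rightarrow> 'a \<Rightarrow> 'a \<Rightarrow> nat \<Rightarrow> 'a list \<Rightarrow> 'a list \<Rightarrow> 'a list \<Rightarrow> bool" where
  "euclid_inv \<sigma> a b k r s t \<longleftrightarrow>
     length r = k + 2 \<and> length s = k + 2 \<and> length t = k + 2 \<and>
     r ! k * \<sigma> (r ! (k + 1)) \<in> sym_elems \<sigma> \<and>
     (\<forall>g. a \<in> right_ideal g \<and> b \<in> right_ideal g \<longleftrightarrow>
          r ! k \<in> right_ideal g \<and> r ! (k + 1) \<in> right_ideal g) \<and>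
     (\<forall>i\<le>k + 1. a * \<sigma> (s ! i) - b * \<sigma> (t ! i) = r ! i) \<and>
     (\<forall>i\<le>k. mat2 (t ! i) (s ! i) ((- 1) ^ i * t ! (i + 1)) ((- 1) ^ i * s ! (i + 1)) \<in> E_sigma \<sigma>)"

lemma euclid_inv_init:
  assumes "involution \<sigma>" and "a * \<sigma> b \<in> sym_elems \<sigma>"
  shows "euclid_inv \<sigma> a b 0 [a, b] [1, 0] [0, - 1]"
  using assms(2) weyl_element_in_E_sigma
  by (auto simp: euclid_inv_def involution_simps[OF assms(1)] le_Suc_eq)

lemma euclid_inv_snoc:
  assumes \<sigma>: "involution \<sigma>" and inv: "euclid_inv \<sigma> a b k r s t" and q: "q \<in> sym_elems \<sigma>"
  shows "euclid_inv \<sigma> a b (Suc k) (r @ [r ! k - r ! (k + 1) * q])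
    (s @ [s ! k - q * s ! (k + 1)]) (t @ [t ! k - q * t ! (k + 1)])"
    (is "euclid_inv _ _ _ _ ?r ?s ?t")
proof -
  have len: "length r = k + 2" "length s = k + 2" "length t = k + 2"
    and sym: "r ! k * \<sigma> (r ! (k + 1)) \<in> sym_elems \<sigma>"
    and ideal: "\<And>g. a \<in> right_ideal g \<and> b \<in> right_ideal g \<longleftrightarrow>
      r ! k \<in> right_ideal g \<and> r ! (k + 1) \<in> right_ideal g"
    and bezout: "\<And>i. i \<le> k + 1 \<Longrightarrow> a * \<sigma> (s ! i) - b * \<sigma> (t ! i) = r ! i"
    and E: "\<And>i. i \<le> k \<Longrightarrow>
      mat2 (t ! i) (s ! i) ((- 1) ^ i * t ! (i + 1)) ((- 1) ^ i * s ! (i + 1)) \<in> E_sigma \<sigma>"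
    using inv by (simp_all add: euclid_inv_def)
  have old: "?r ! i = r ! i" "?s ! i = s ! i" "?t ! i = t ! i" if "i \<le> k + 1" for i
    using that by (simp_all add: len nth_append)
  have new: "?r ! (k + 2) = r ! k - r ! (k + 1) * q" "?s ! (k + 2) = s ! k - q * s ! (k + 1)"
    "?t ! (k + 2) = t ! k - q * t ! (k + 1)"
    using len by (simp_all add: nth_append)
  have "\<sigma> q = q"
    using q by (simp add: sym_elems_def)
  have "a * \<sigma> (?s ! (k + 2)) - b * \<sigma> (?t ! (k + 2)) =
      (a * \<sigma> (s ! k) - b * \<sigma> (t ! k)) - (a * \<sigma> (s ! (k + 1)) - b * \<sigma> (t ! (k + 1))) * q"
    unfolding new
    by (simp add: sigma_diff[OF \<sigma>] involution_simps(2)[OF \<sigma>] \<open>\<sigma> q = q\<close> algebra_simps)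
  then have bezout_new: "a * \<sigma> (?s ! (k + 2)) - b * \<sigma> (?t ! (k + 2)) = ?r ! (k + 2)"
    unfolding new by (simp add: bezout)
  have bezout': "a * \<sigma> (?s ! i) - b * \<sigma> (?t ! i) = ?r ! i" if "i \<le> k + 2" for i
  proof (cases "i = k + 2")
    case False
    with that have "i \<le> k + 1" by simp
    with bezout old show ?thesis by simp
  qed (use bezout_new in simp)
  have E': "mat2 (?t ! i) (?s ! i) ((- 1) ^ i * ?t ! (i + 1)) ((- 1) ^ i * ?s ! (i + 1)) \<in> E_sigma \<sigma>"
    if "i \<le> k + 1" for i
  proof (cases "i = k + 1")
    case True
    then have "i + 1 = k + 2" by simp
    with E_sigma_step[OF \<sigma> q E[of k]] show ?thesis
      unfolding \<open>i + 1 = k + 2\<close> new old[OF that] unfolding True by simp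
  next
    case False
    with that have "i \<le> k" "i + 1 \<le> k + 1" by simp_all
    show ?thesis
      unfolding old[OF that] old[OF \<open>i + 1 \<le> k + 1\<close>] by (rule E) fact
  qed
  have "?r ! (k + 1) * \<sigma> (?r ! (k + 2)) \<in> sym_elems \<sigma>"
    unfolding new using sym_elems_mult_sigma_step[OF \<sigma> sym q] old(1)[of "k + 1"] by simp
  moreover have "a \<in> right_ideal g \<and> b \<in> right_ideal g \<longleftrightarrow>
      ?r ! (k + 1) \<in> right_ideal g \<and> ?r ! (k + 2) \<in> right_ideal g" for g
    unfolding new ideal using right_ideal_diff_mult_iff[of "r ! (k + 1)" g "r ! k" q]
    using old(1)[of "k + 1"] by auto
  ultimately show ?thesis
    using bezout' E' len unfolding euclid_inv_def by simp
qed

lemma euclid_inv_step: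
  assumes "involution \<sigma>" and "division_function \<sigma> \<Phi> f"
    and inv: "euclid_inv \<sigma> a b k r s t" and "last r \<noteq> 0"
  shows "\<exists>r' s' t'. euclid_step f (r, s, t) = (r', s', t') \<and> euclid_inv \<sigma> a b (Suc k) r' s' t' \<and>
    \<Phi> (last r') < \<Phi> (last r)"
proof -
  have len: "length r = k + 2" and sym: "r ! k * \<sigma> (r ! (k + 1)) \<in> sym_elems \<sigma>"
    using inv by (simp_all add: euclid_inv_def)
  have last: "last r = r ! (k + 1)"
    using len by (cases r rule: rev_cases) (auto simp: nth_append)
  obtain q where q: "q \<in> sym_elems \<sigma>"
    and f: "f (r ! k, r ! (k + 1)) = (q, r ! k - r ! (k + 1) * q)"
    and less: "\<Phi> (r ! k - r ! (k + 1) * q) < \<Phi> (r ! (k + 1))"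
    using assms(2,4) sym unfolding division_function_def last by blast
  have "euclid_step f (r, s, t) = (r @ [r ! k - r ! (k + 1) * q],
      s @ [s ! k - q * s ! (k + 1)], t @ [t ! k - q * t ! (k + 1)])"
    using f by (simp add: euclid_step_def len)
  with euclid_inv_snoc[OF assms(1) inv q] less show ?thesis
    by (auto simp: last)
qed

theorem euclid_terminates:
  assumes "involution \<sigma>" and "division_function \<sigma> \<Phi> f" and "a * \<sigma> b \<in> sym_elems \<sigma>"
  shows "\<exists>r s t k. euclid f a b = Some (r, s, t) \<and> euclid_inv \<sigma> a b k r s t \<and> last r = 0"
proof -
  define P where "P = (\<lambda>(r, s, t). \<exists>k. euclid_inv \<sigma> a b k r s t)"
  define continue :: "'a list \<times> 'a list \<times> 'a list \<Rightarrow> bool" where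
    "continue = (\<lambda>(r, s, t). last r \<noteq> 0)"
  have euclid: "euclid f a b = while_option continue (euclid_step f) ([a, b], [1, 0], [0, - 1])"
    by (simp add: euclid_def continue_def)
  have init: "P ([a, b], [1, 0], [0, - 1])"
    using euclid_inv_init[OF assms(1,3)] by (auto simp: P_def)
  have step: "P (euclid_step f x) \<and> \<Phi> (last (fst (euclid_step f x))) < \<Phi> (last (fst x))"
    if "P x" "continue x" for x
    using that euclid_inv_step[OF assms(1,2)]
    by (cases x) (fastforce simp: P_def continue_def)
  have "wf {(y, x). (P x \<and> continue x) \<and> y = euclid_step f x}"
    by (rule wf_subset[OF wf_inv_image[OF wf, of "\<lambda>x. \<Phi> (last (fst x))"]])
      (auto simp: inv_image_def dest: step)
  then obtain x where x: "euclid f a b = Some x"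
    using wf_while_option_Some[of P continue "euclid_step f"] step init unfolding euclid by blast
  have "P x" "\<not> continue x"
    using while_option_rule[of P, OF _ x[unfolded euclid] init] step
      while_option_stop[OF x[unfolded euclid]] by blast+
  with x show ?thesis
    by (cases x) (auto simp: P_def continue_def)
qed

theorem mainTheorem4:
  fixes \<sigma> :: "'a::ring_1_no_zero_divisors \<Rightarrow> 'a"
    and \<Phi> :: "'a \<Rightarrow> 'w::wellorder"
    and f :: "'a \<times> 'a \<Rightarrow> 'a \<times> 'a"
    and a b :: 'a
  assumes "sigma_Euclidean \<sigma> \<Phi>"
    and "division_function \<sigma> \<Phi> f"
    and "a * \<sigma> b \<in> sym_elems \<sigma>"
  shows "\<exists>r s t k. euclid f a b = Some (r, s, t) \<and>
    length r = k + 2 \<and> length s = k + 2 \<and> length t = k + 2 \<and>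
    r ! (k + 1) = 0 \<and>
    is_right_gcd (r ! k) a b \<and>
    (\<forall>i\<le>k + 1. a * \<sigma> (s ! i) - b * \<sigma> (t ! i) = r ! i \<and> s ! i * \<sigma> (t ! i) \<in> sym_elems \<sigma>) \<and>
    (\<forall>i\<le>k. mat2 (t ! i) (s ! i) ((- 1) ^ i * t ! (i + 1)) ((- 1) ^ i * s ! (i + 1)) \<in> E_sigma \<sigma>)"
proof -
  have \<sigma>: "involution \<sigma>"
    using assms(1) by (simp add: sigma_Euclidean_def)
  obtain r s t k where euclid: "euclid f a b = Some (r, s, t)"
    and inv: "euclid_inv \<sigma> a b k r s t" and "last r = 0"
    using euclid_terminates[OF \<sigma> assms(2,3)] by blast
  have len: "length r = k + 2" "length s = k + 2" "length t = k + 2"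
    and ideal: "\<And>g. a \<in> right_ideal g \<and> b \<in> right_ideal g \<longleftrightarrow>
      r ! k \<in> right_ideal g \<and> r ! (k + 1) \<in> right_ideal g"
    and bezout: "\<forall>i\<le>k + 1. a * \<sigma> (s ! i) - b * \<sigma> (t ! i) = r ! i"
    and E: "\<forall>i\<le>k. mat2 (t ! i) (s ! i) ((- 1) ^ i * t ! (i + 1)) ((- 1) ^ i * s ! (i + 1)) \<in> E_sigma \<sigma>"
    using inv by (simp_all add: euclid_inv_def)
  have zero: "r ! (k + 1) = 0"
    using \<open>last r = 0\<close> len(1) by (cases r rule: rev_cases) (auto simp: nth_append)
  have gcd: "is_right_gcd (r ! k) a b"
    using ideal unfolding is_right_gcd_def zero
    by (auto simp: self_in_right_ideal zero_in_right_ideal)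
  have SL: "mat2 (t ! i) (s ! i) ((- 1) ^ i * t ! (i + 1)) ((- 1) ^ i * s ! (i + 1))
      \<in> carrier (SL_sigma \<sigma>)" if "i \<le> k" for i
    using E E_sigma_subset_SL_sigma[OF \<sigma>] that by blast
  have sym: "s ! i * \<sigma> (t ! i) \<in> sym_elems \<sigma>" if "i \<le> k + 1" for i
  proof (cases "i = k + 1")
    case False
    with that have "i \<le> k" by simp
    from SL_sigma_rows_symmetric(1)[OF \<sigma> SL[OF this]] show ?thesis by simp
  next
    \<comment> \<open>The last pair occurs only as the second row of the matrix with index \<open>k\<close>, up to sign.\<close>
    case True
    have "((- 1) ^ k * s ! (k + 1)) * \<sigma> ((- 1) ^ k * t ! (k + 1)) \<in> sym_elems \<sigma>"
      using SL_sigma_rows_symmetric(2)[OF \<sigma> SL[of k]] by simp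
    then show ?thesis
      unfolding True by (cases "even k") (simp_all add: involution_simps[OF \<sigma>])
  qed
  show ?thesis
    using euclid len zero gcd bezout sym E by blast
qed

end
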